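(* Let $(U,\oplus,\odot,\underline{0},\underline{1},\geq,>,\mathsf{pos})$ be an ordered arctic semiring. Let $\mathcal{F}$ be a signature and $\mathcal{V}$ a set of variables, and let $\mathcal{P}ol$ be a polynomial interpretation assigning to every $n$-ary symbol $f\in\mathcal{F}$ a linear polynomial $[f](x_1,\dots,x_n)=f_0\oplus f_1\odot x_1\oplus\cdots\oplus f_n\odot x_n$ with $f_0,\dots,f_n\in U$ such that $\mathsf{pos}(f_i)$ holds for some $0\leq i\leq n$. Let $\succsim_{\mathcal{P}ol}$ and $\succ_{\mathcal{P}ol}$ be the relations on terms over $\mathcal{F}$ and $\mathcal{V}$ induced by $\mathcal{P}ol$ (see context). Then $(\succsim_{\mathcal{P}ol},\succ_{\mathcal{P}ol})$ is a reduction pair. Moreover, these relations are approximated by component-wise comparison of coefficients: for all terms $s,t$ with $[s]=c\oplus\bigoplus_{x}a_x\odot x$ and $[t]=d\oplus\bigoplus_x b_x\odot x$ as formal linear polynomials, if $c>d$ and $a_x>b_x$ for all variables $x$ then $s\succ_{\mathcal{P}ol}t$, and if $c\geq d$ and $a_x\geq b_x$ for all variables $x$ then $s\succsim_{\mathcal{P}ol}t$.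
   Context: Semiring with one-element: a structure $(U,\oplus,\odot,\underline{0},\underline{1})$ with binary operations $\oplus,\odot$ on $U$ and $\underline{0},\underline{1}\in U$ such that $\oplus$ and $\odot$ are associative, $\oplus$ is commutative, $\underline{0}\neq\underline{1}$, $\underline{0}$ is neutral for $\oplus$, $\underline{1}$ is neutral for $\odot$, $\underline{0}\odot x=x\odot\underline{0}=\underline{0}$, and $\odot$ distributes over $\oplus$ on both sides. ($\odot$ need not be commutative.) Ordered arctic semiring: a structure $(U,\oplus,\odot,\underline{0},\underline{1},\geq,>,\mathsf{pos})$, with $\geq,>$ binary relations and $\mathsf{pos}$ a unary predicate on $U$, such that $(U,\oplus,\odot,\underline{0},\underline{1})$ is a semiring with one-element and, for all $x,x',y,y',z\in U$, - $\geq$ is reflexive and transitive; $>$ is transitive; ${>}\circ{\geq}\subseteq{>}$ and ${\geq}\circ{>}\subseteq{>}$ (i.e. $x>y\geq z$ implies $x>z$, and $x\geq y>z$ implies $x>z$); - $\underline{1}\geq\underline{0}$; $\mathsf{pos}(\underline{1})$; $x>\underline{0}$; $x\geq\underline{0}$; and if $\underline{0}>x$ then $x=\underline{0}$ (in particular $\underline{0}>\underline{0}$ holds); - if $x\geq y$ then $x\oplus z\geq y\oplus z$; - if $x>y$ and $x'>y'$ then $x\oplus x'>y\oplus y'$; - if $x\geq y$ then $x\odot z\geq y\odot z$ and $z\odot x\geq z\odot y$; if $x>y$ then $x\odot z>y\odot z$; - if $\mathsf{pos}(x)$ and $\mathsf{pos}(y)$ then $\mathsf{pos}(x\oplus z)$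 and $\mathsf{pos}(x\odot y)$; - $\{(x,y)\mid x>y\wedge\mathsf{pos}(y)\}$ is well-founded, i.e. there is no infinite sequence $x_1>x_2>x_3>\cdots$ with $\mathsf{pos}(x_i)$ for all $i\geq2$. Induced relations: an assignment is a map $\alpha:\mathcal{V}\to\{u\in U\mid\mathsf{pos}(u)\}$. The value of a term is $[x]_\alpha=\alpha(x)$ for variables $x$ and $[f(t_1,\dots,t_n)]_\alpha=f_0\oplus f_1\odot[t_1]_\alpha\oplus\cdots\oplus f_n\odot[t_n]_\alpha$. Define $s\succ_{\mathcal{P}ol}t$ iff $[s]_\alpha>[t]_\alpha$ for all assignments $\alpha$, and $s\succsim_{\mathcal{P}ol}t$ iff $[s]_\alpha\geq[t]_\alpha$ for all assignments $\alpha$. Formal linear polynomial of a term: $[t]=c\oplus\bigoplus_{x\in\mathcal{V}}a_x\odot x$ is obtained by homomorphic extension of $\mathcal{P}ol$: a variable $x$ is mapped to the polynomial with constant part $\underline{0}$, coefficient $\underline{1}$ for $x$ and $\underline{0}$ for all other variables; and $[f(t_1,\dots,t_n)]=[f]([t_1],\dots,[t_n])$, expanded by distributivity. Variables not occurring have coefficient $\underline{0}$. Reduction pair: a pair $(\succsim,\succ)$ of transitive relations on terms such that $\succsim$ and $\succ$ are stable (closed under substitutions), $\succsim$ is reflexive and monotone (closed under contexts), $\succ$ is well-founded (no infinite sequence $t_1\succ t_2\succ\cdots$), and ${\succsim}\circ{\succ}\subseteq{\succ}$. *)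

theory Defs
  imports Main
begin

(* The carrier U is the type 'a; the class semiring_1 is exactly the notion of a (possibly
   non-commutative) semiring with 0 \<noteq> 1. *)
locale ordered_arctic_semiring =
  fixes geq :: "'a :: semiring_1 \<Rightarrow> 'a \<Rightarrow> bool" (infix "\<succeq>" 50)
    and gt :: "'a \<Rightarrow> 'a \<Rightarrow> bool" (infix "\<succ>" 50)
    and pos :: "'a \<Rightarrow> bool"
  assumes geq_refl: "x \<succeq> x"
    and geq_trans: "x \<succeq> y \<Longrightarrow> y \<succeq> z \<Longrightarrow> x \<succeq> z"
    and gt_trans: "x \<succ> y \<Longrightarrow> y \<succ> z \<Longrightarrow> x \<succ> z"
    and gt_geq_trans: "x \<succ> y \<Longrightarrow> y \<succeq> z \<Longrightarrow> x \<succ> z"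
    and geq_gt_trans: "x \<succeq> y \<Longrightarrow> y \<succ> z \<Longrightarrow> x \<succ> z"
    and one_geq_zero: "1 \<succeq> 0"
    and pos_one: "pos 1"
    and gt_zero: "x \<succ> 0"
    and geq_zero: "x \<succeq> 0"
    and zero_gt: "0 \<succ> x \<Longrightarrow> x = 0"
    and plus_mono: "x \<succeq> y \<Longrightarrow> x + z \<succeq> y + z"
    and plus_strict_mono: "x \<succ> y \<Longrightarrow> x' \<succ> y' \<Longrightarrow> x + x' \<succ> y + y'"
    and times_mono: "x \<succeq> y \<Longrightarrow> x * z \<succeq> y * z \<and> z * x \<succeq> z * y"
    and times_strict_mono: "x \<succ> y \<Longrightarrow> x * z \<succ> y * z"
    and pos_closed: "pos x \<Longrightarrow> pos y \<Longrightarrow> pos (x + z) \<and> pos (x * y)"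
    and well_founded: "\<not> (\<exists>x :: nat \<Rightarrow> 'a. \<forall>i. x i \<succ> x (Suc i) \<and> pos (x (Suc i)))"

datatype ('f, 'v) trm = Var 'v | Fun 'f "('f, 'v) trm list"

datatype ('f, 'v) ctxt =
  Hole | More 'f "('f, 'v) trm list" "('f, 'v) ctxt" "('f, 'v) trm list"

(* A signature is a set F of symbols together with an arity function ar
   (relevant on F only). *)
inductive_set trms :: "'f set \<Rightarrow> ('f \<Rightarrow> nat) \<Rightarrow> 'v set \<Rightarrow> ('f, 'v) trm set"
  for F :: "'f set" and ar :: "'f \<Rightarrow> nat" and V :: "'v set" where
  Var: "x \<in> V \<Longrightarrow> Var x \<in> trms F ar V"
| Fun: "f \<in> F \<Longrightarrow> length ts = ar f \<Longrightarrow> (\<And>t. t \<in> set ts \<Longrightarrow> t \<in> trms F ar V)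
    \<Longrightarrow> Fun f ts \<in> trms F ar V"

inductive_set ctxts :: "'f set \<Rightarrow> ('f \<Rightarrow> nat) \<Rightarrow> 'v set \<Rightarrow> ('f, 'v) ctxt set"
  for F :: "'f set" and ar :: "'f \<Rightarrow> nat" and V :: "'v set" where
  Hole: "Hole \<in> ctxts F ar V"
| More: "f \<in> F \<Longrightarrow> length us + 1 + length ws = ar f \<Longrightarrow> set us \<subseteq> trms F ar V
    \<Longrightarrow> set ws \<subseteq> trms F ar V \<Longrightarrow> C \<in> ctxts F ar V \<Longrightarrow> More f us C ws \<in> ctxts F ar V"

primrec subst :: "('v \<Rightarrow> ('f, 'v) trm) \<Rightarrow> ('f, 'v) trm \<Rightarrow> ('f, 'v) trm" where
  "subst \<sigma> (Var x) = \<sigma> x"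
| "subst \<sigma> (Fun f ts) = Fun f (map (subst \<sigma>) ts)"

primrec fill :: "('f, 'v) ctxt \<Rightarrow> ('f, 'v) trm \<Rightarrow> ('f, 'v) trm" where
  "fill Hole t = t"
| "fill (More f us C ws) t = Fun f (us @ fill C t # ws)"

definition stable ::
  "'f set \<Rightarrow> ('f \<Rightarrow> nat) \<Rightarrow> 'v set \<Rightarrow> ('f, 'v) trm rel \<Rightarrow> bool" where
  "stable F ar V R \<longleftrightarrow> (\<forall>\<sigma>. (\<forall>x\<in>V. \<sigma> x \<in> trms F ar V) \<longrightarrow>
     (\<forall>(s, t)\<in>R. (subst \<sigma> s, subst \<sigma> t) \<in> R))"

definition monotone_ctxt ::
  "'f set \<Rightarrow> ('f \<Rightarrow> nat) \<Rightarrow> 'v set \<Rightarrow> ('f, 'v) trm rel \<Rightarrow> bool" where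
  "monotone_ctxt F ar V R \<longleftrightarrow> (\<forall>C\<in>ctxts F ar V. \<forall>(s, t)\<in>R. (fill C s, fill C t) \<in> R)"

(* S is the quasi-relation, R the strict one. *)
definition reduction_pair ::
  "'f set \<Rightarrow> ('f \<Rightarrow> nat) \<Rightarrow> 'v set \<Rightarrow> ('f, 'v) trm rel \<Rightarrow> ('f, 'v) trm rel \<Rightarrow> bool" where
  "reduction_pair F ar V S R \<longleftrightarrow>
     S \<subseteq> trms F ar V \<times> trms F ar V \<and> R \<subseteq> trms F ar V \<times> trms F ar V \<and>
     trans S \<and> trans R \<and>
     stable F ar V S \<and> stable F ar V R \<and>
     refl_on (trms F ar V) S \<and> monotone_ctxt F ar V S \<and>
     \<not> (\<exists>t :: nat \<Rightarrow> ('f, 'v) trm. \<forall>i. (t i, t (Suc i)) \<in> R) \<and>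
     S O R \<subseteq> R"

lemma size_nth_trm [termination_simp]: "i < length ts \<Longrightarrow> size (ts ! i) < Suc (size_list size ts)"
  by (meson le_imp_less_Suc nth_mem order_refl size_list_estimation')

(* A linear polynomial interpretation I assigns to an n-ary symbol f the coefficients
   I f 0, ..., I f n, where I f 0 is the constant part and I f i belongs to the i-th argument;
   the values I f i for i > n are irrelevant. As argument lists are indexed from 0, the
   coefficient of ts ! i is I f (Suc i). *)
fun val :: "('f \<Rightarrow> nat \<Rightarrow> 'a :: semiring_1) \<Rightarrow> ('v \<Rightarrow> 'a) \<Rightarrow> ('f, 'v) trm \<Rightarrow> 'a" where
  "val I \<alpha> (Var x) = \<alpha> x"
| "val I \<alpha> (Fun f ts) = I f 0 + (\<Sum>i<length ts. I f (Suc i) * val I \<alpha> (ts ! i))"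

(* Only the restriction of an assignment to V matters. *)
definition assignment :: "'v set \<Rightarrow> ('a \<Rightarrow> bool) \<Rightarrow> ('v \<Rightarrow> 'a) \<Rightarrow> bool" where
  "assignment V pos \<alpha> \<longleftrightarrow> (\<forall>x\<in>V. pos (\<alpha> x))"

(* Used with both the weak and the strict relation of the semiring as cmp. *)
definition pol_rel ::
  "'f set \<Rightarrow> ('f \<Rightarrow> nat) \<Rightarrow> 'v set \<Rightarrow> ('a :: semiring_1 \<Rightarrow> bool) \<Rightarrow> ('f \<Rightarrow> nat \<Rightarrow> 'a)
    \<Rightarrow> ('a \<Rightarrow> 'a \<Rightarrow> bool) \<Rightarrow> ('f, 'v) trm rel" where
  "pol_rel F ar V pos I cmp = {(s, t). s \<in> trms F ar V \<and> t \<in> trms F ar V \<and>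
     (\<forall>\<alpha>. assignment V pos \<alpha> \<longrightarrow> cmp (val I \<alpha> s) (val I \<alpha> t))}"

(* The pair (c, a) stands for the formal linear polynomial with constant part c and
   coefficient a x for each variable x. *)
fun lin_poly :: "('f \<Rightarrow> nat \<Rightarrow> 'a :: semiring_1) \<Rightarrow> ('f, 'v) trm \<Rightarrow> 'a \<times> ('v \<Rightarrow> 'a)" where
  "lin_poly I (Var x) = (0, \<lambda>y. if y = x then 1 else 0)"
| "lin_poly I (Fun f ts) =
     (I f 0 + (\<Sum>i<length ts. I f (Suc i) * fst (lin_poly I (ts ! i))),
      \<lambda>x. \<Sum>i<length ts. I f (Suc i) * snd (lin_poly I (ts ! i)) x)"

end

(* The hypothesis on the interpretation makes every term value positive, because pos survives
   adding arbitrary elements. Hence an infinite strictly decreasing sequence of terms, evaluated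
   at the constant assignment 1, would contradict well-foundedness on positive elements, and
   stability holds because the values of the substituted terms again form an assignment.
   For the comparison of coefficients, the infinitely many zero coefficients are cut off by
   summing only over the variables that occur in s or t; since 0 > 0, the strict relation is
   compatible with empty sums. *)
theory Submission
  imports Defs
begin

context ordered_arctic_semiring
begin

lemma plus_mono2: "x \<succeq> y \<Longrightarrow> x' \<succeq> y' \<Longrightarrow> x + x' \<succeq> y + y'"
  by (metis add.commute geq_trans plus_mono)

lemma sum_geq: "(\<And>i. i \<in> A \<Longrightarrow> f i \<succeq> g i) \<Longrightarrow> sum f A \<succeq> sum g A"
  by (induction A rule: infinite_finite_induct) (auto intro: geq_refl plus_mono2)

text \<open>Over an empty or infinite \<open>A\<close> both sums are 0, and \<open>gt_zero\<close>
  provides 0 > 0.\<close>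

lemma sum_gt: "(\<And>i. i \<in> A \<Longrightarrow> f i \<succ> g i) \<Longrightarrow> sum f A \<succ> sum g A"
  by (induction A rule: infinite_finite_induct) (auto intro: gt_zero plus_strict_mono)

text \<open>\<open>pos_closed\<close> asks for a second positive element as well; 1 can serve as
  that element.\<close>

lemma pos_plus_left: "pos x \<Longrightarrow> pos (x + z)"
  using pos_closed pos_one by blast

lemma pos_plus_right: "pos x \<Longrightarrow> pos (z + x)"
  by (metis add.commute pos_plus_left)

lemma pos_sum: "finite A \<Longrightarrow> i \<in> A \<Longrightarrow> pos (f i) \<Longrightarrow> pos (sum f A)"
  by (simp add: sum.remove pos_plus_left)

lemma pos_val:
  assumes "\<forall>f\<in>F. \<exists>i\<le>ar f. pos (I f i)" and "assignment V pos \<alpha>" and "t \<in> trms F ar V"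
  shows "pos (val I \<alpha> t)"
  using assms(3)
proof induction
  case (Var x)
  then show ?case using assms(2) by (simp add: assignment_def)
next
  case (Fun f ts)
  obtain i where i: "i \<le> ar f" "pos (I f i)" using assms(1) Fun.hyps by blast
  show ?case
  proof (cases i)
    case 0
    then show ?thesis using i by (simp add: pos_plus_left)
  next
    case (Suc j)
    \<comment> \<open>Coefficient \<open>Suc j\<close> belongs to argument \<open>j\<close>, because
      index 0 is the constant part. The product with that argument's value is positive, and one
      positive summand suffices.\<close>
    then have "j < length ts" using i Fun.hyps by simp
    moreover from this have "pos (I f (Suc j) * val I \<alpha> (ts ! j))"
      using i Suc Fun.IH pos_closed by simp
    ultimately have "pos (\<Sum>i<length ts. I f (Suc i) * val I \<alpha> (ts ! i))"
      by (intro pos_sum[of _ j]) auto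
    then show ?thesis by (simp add: pos_plus_right)
  qed
qed

end

lemma val_subst: "val I \<alpha> (subst \<sigma> t) = val I (\<lambda>x. val I \<alpha> (\<sigma> x)) t"
  by (induction t) simp_all

lemma subst_in_trms:
  "t \<in> trms F ar V \<Longrightarrow> \<forall>x\<in>V. \<sigma> x \<in> trms F ar V \<Longrightarrow> subst \<sigma> t \<in> trms F ar V"
  by (induction rule: trms.induct) (auto intro!: trms.Fun)

lemma fill_in_trms: "C \<in> ctxts F ar V \<Longrightarrow> t \<in> trms F ar V \<Longrightarrow> fill C t \<in> trms F ar V"
  by (induction rule: ctxts.induct) (auto intro!: trms.Fun)

lemma set2_trm_subset: "t \<in> trms F ar V \<Longrightarrow> set2_trm t \<subseteq> V"
  by (induction rule: trms.induct) auto

lemma finite_set2_trm: "finite (set2_trm t)"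
  by (induction t) auto

text \<open>Allowing any finite superset \<open>X\<close> of the occurring variables lets two terms
  be expanded over the same index set.\<close>

lemma val_eq_lin_poly:
  assumes "finite X" and "set2_trm t \<subseteq> X"
  shows "val I \<alpha> t = fst (lin_poly I t) + (\<Sum>x\<in>X. snd (lin_poly I t) x * \<alpha> x)"
  using assms(2)
proof (induction t)
  case (Var x)
  then show ?case using assms(1) by (simp add: if_distrib[of "\<lambda>a. a * _"] cong: if_cong)
next
  case (Fun f ts)
  let ?c = "\<lambda>i. fst (lin_poly I (ts ! i))" and ?a = "\<lambda>i. snd (lin_poly I (ts ! i))"
  have "(\<Sum>i<length ts. I f (Suc i) * val I \<alpha> (ts ! i)) =
      (\<Sum>i<length ts. I f (Suc i) * (?c i + (\<Sum>x\<in>X. ?a i x * \<alpha> x)))"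
    using Fun by (intro sum.cong) (auto simp: UN_subset_iff)
  also have "\<dots> = (\<Sum>i<length ts. I f (Suc i) * ?c i) +
      (\<Sum>i<length ts. \<Sum>x\<in>X. I f (Suc i) * ?a i x * \<alpha> x)"
    by (simp add: distrib_left sum.distrib sum_distrib_left mult.assoc)
  \<comment> \<open>Exchanging the sums collects the monomials by variable;
    \<open>\<alpha> x\<close> stands on the right throughout, so it factors out without
    commutativity.\<close>
  also have "(\<Sum>i<length ts. \<Sum>x\<in>X. I f (Suc i) * ?a i x * \<alpha> x) =
      (\<Sum>x\<in>X. (\<Sum>i<length ts. I f (Suc i) * ?a i x) * \<alpha> x)"
    by (subst sum.swap) (simp add: sum_distrib_right)
  finally show ?case by (simp add: add.assoc)
qed

text \<open>Stated for an abstract \<open>cmp\<close> to treat both relations at once. Coefficients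
  stand to the left of variables, so compatibility with multiplication from the right is the form
  required, and this is what the strict relation offers.\<close>

lemma lin_poly_pol_rel:
  assumes "s \<in> trms F ar V" and "t \<in> trms F ar V"
    and plus: "\<And>x y x' y'. cmp x y \<Longrightarrow> cmp x' y' \<Longrightarrow> cmp (x + x') (y + y')"
    and times: "\<And>x y z. cmp x y \<Longrightarrow> cmp (x * z) (y * z)"
    and sum: "\<And>A f g. (\<And>x :: 'v. x \<in> A \<Longrightarrow> cmp (f x) (g x)) \<Longrightarrow> cmp (sum f A) (sum g A)"
    and "cmp (fst (lin_poly I s)) (fst (lin_poly I t))"
    and "\<forall>x\<in>V. cmp (snd (lin_poly I s) x) (snd (lin_poly I t) x)"
  shows "(s, t :: ('f, 'v) trm) \<in> pol_rel F ar V pos I cmp"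
proof -
  let ?X = "set2_trm s \<union> set2_trm t"
  have X: "finite ?X" "?X \<subseteq> V"
    using finite_set2_trm set2_trm_subset assms(1,2) by blast+
  have "cmp (val I \<alpha> s) (val I \<alpha> t)" for \<alpha>
    unfolding val_eq_lin_poly[OF X(1) Un_upper1, of I \<alpha>]
      val_eq_lin_poly[OF X(1) Un_upper2, of I \<alpha>]
    using X(2) assms(6,7) by (intro plus sum times) auto
  then show ?thesis using assms(1,2) by (simp add: pol_rel_def)
qed

lemma trans_pol_rel:
  assumes "\<And>x y z. cmp x y \<Longrightarrow> cmp y z \<Longrightarrow> cmp x z"
  shows "trans (pol_rel F ar V pos I cmp)"
  unfolding trans_def pol_rel_def using assms by blast

context ordered_arctic_semiring
begin

text \<open>By \<open>val_subst\<close>, comparing substituted terms under \<open>\<alpha>\<close>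
  is comparing the original terms under another assignment, whose positivity is
  \<open>pos_val\<close>.\<close>

lemma stable_pol_rel:
  assumes "\<forall>f\<in>F. \<exists>i\<le>ar f. pos (I f i)"
  shows "stable F ar V (pol_rel F ar V pos I cmp)"
proof -
  have "assignment V pos (\<lambda>x. val I \<alpha> (\<sigma> x))"
    if "assignment V pos \<alpha>" "\<forall>x\<in>V. \<sigma> x \<in> trms F ar V" for \<alpha> \<sigma>
    using pos_val[OF assms that(1)] that(2) by (simp add: assignment_def)
  then show ?thesis
    by (auto simp: stable_def pol_rel_def val_subst subst_in_trms)
qed

text \<open>Here coefficients multiply values from the left, a monotonicity that the axioms grant to
  \<open>\<succeq>\<close> only.\<close>

lemma val_fill_geq: "val I \<alpha> s \<succeq> val I \<alpha> t \<Longrightarrow> val I \<alpha> (fill C s) \<succeq> val I \<alpha> (fill C t)"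
proof (induction C)
  case (More f us C ws)
  \<comment> \<open>Away from position \<open>length us\<close> the two lists agree, even for
    \<open>i\<close> out of range, so reflexivity applies.\<close>
  then have "val I \<alpha> ((us @ fill C s # ws) ! i) \<succeq> val I \<alpha> ((us @ fill C t # ws) ! i)" for i
    by (auto simp: nth_append nth_Cons' geq_refl)
  then have "I f 0 + (\<Sum>i<length us + Suc (length ws). I f (Suc i) * val I \<alpha> ((us @ fill C s # ws) ! i)) \<succeq>
      I f 0 + (\<Sum>i<length us + Suc (length ws). I f (Suc i) * val I \<alpha> ((us @ fill C t # ws) ! i))"
    using times_mono by (intro plus_mono2 geq_refl sum_geq) auto
  then show ?case by simp
qed simp

lemma no_infinite_pol_rel_gt:
  assumes "\<forall>f\<in>F. \<exists>i\<le>ar f. pos (I f i)"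
  shows "\<not> (\<exists>t :: nat \<Rightarrow> ('f, 'v) trm. \<forall>i. (t i, t (Suc i)) \<in> pol_rel F ar V pos I gt)"
proof
  assume "\<exists>t :: nat \<Rightarrow> ('f, 'v) trm. \<forall>i. (t i, t (Suc i)) \<in> pol_rel F ar V pos I gt"
  then obtain t :: "nat \<Rightarrow> ('f, 'v) trm"
    where t: "\<And>i. (t i, t (Suc i)) \<in> pol_rel F ar V pos I gt" by blast
  have 1: "assignment V pos (\<lambda>_. 1)" by (simp add: assignment_def pos_one)
  then have "val I (\<lambda>_. 1) (t i) \<succ> val I (\<lambda>_. 1) (t (Suc i))
      \<and> pos (val I (\<lambda>_. 1) (t (Suc i)))" for i
    using t[of i] pos_val[OF assms 1] by (simp add: pol_rel_def)
  then have "\<exists>x :: nat \<Rightarrow> 'a. \<forall>i. x i \<succ> x (Suc i) \<and> pos (x (Suc i))"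
    by (intro exI[of _ "\<lambda>i. val I (\<lambda>_. 1) (t i)"]) simp
  then show False using well_founded by contradiction
qed

lemma reduction_pair_pol_rel:
  assumes "\<forall>f\<in>F. \<exists>i\<le>ar f. pos (I f i)"
  shows "reduction_pair F ar V (pol_rel F ar V pos I geq) (pol_rel F ar V pos I gt)"
  unfolding reduction_pair_def
proof (intro conjI)
  show "trans (pol_rel F ar V pos I geq)" "trans (pol_rel F ar V pos I gt)"
    by (rule trans_pol_rel, blast intro: geq_trans gt_trans)+
  show "refl_on (trms F ar V) (pol_rel F ar V pos I geq)"
    by (auto simp: refl_on_def pol_rel_def geq_refl)
  show "monotone_ctxt F ar V (pol_rel F ar V pos I geq)"
    by (auto simp: monotone_ctxt_def pol_rel_def fill_in_trms val_fill_geq)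
  show "pol_rel F ar V pos I geq O pol_rel F ar V pos I gt \<subseteq> pol_rel F ar V pos I gt"
    by (auto simp: pol_rel_def intro: geq_gt_trans)
\<comment> \<open>Left over are stability, well-foundedness and the inclusions in the set of terms;
  \<open>[simplified]\<close> gives the negated existential the shape that the goal takes under
  simplification.\<close>
qed (simp_all add: assms stable_pol_rel no_infinite_pol_rel_gt[simplified],
  auto simp: pol_rel_def)

end

theorem theorem11:
  fixes geq gt :: "'a :: semiring_1 \<Rightarrow> 'a \<Rightarrow> bool"
    and pos :: "'a \<Rightarrow> bool"
    and F :: "'f set" and ar :: "'f \<Rightarrow> nat" and V :: "'v set"
    and I :: "'f \<Rightarrow> nat \<Rightarrow> 'a"
  assumes "ordered_arctic_semiring geq gt pos"
    and "\<forall>f\<in>F. \<exists>i\<le>ar f. pos (I f i)"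
  shows "reduction_pair F ar V (pol_rel F ar V pos I geq) (pol_rel F ar V pos I gt) \<and>
    (\<forall>s\<in>trms F ar V. \<forall>t\<in>trms F ar V. \<forall>c a d b.
       lin_poly I s = (c, a) \<longrightarrow> lin_poly I t = (d, b) \<longrightarrow>
         (gt c d \<and> (\<forall>x\<in>V. gt (a x) (b x)) \<longrightarrow> (s, t) \<in> pol_rel F ar V pos I gt) \<and>
         (geq c d \<and> (\<forall>x\<in>V. geq (a x) (b x)) \<longrightarrow> (s, t) \<in> pol_rel F ar V pos I geq))"
proof -
  interpret ordered_arctic_semiring geq gt pos by fact
  show ?thesis
  proof (intro conjI ballI allI impI)
    show "reduction_pair F ar V (pol_rel F ar V pos I geq) (pol_rel F ar V pos I gt)"
      using assms(2) by (rule reduction_pair_pol_rel)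
  next
    fix s t :: "('f, 'v) trm" and c a d b
    assume st: "s \<in> trms F ar V" "t \<in> trms F ar V"
      and "lin_poly I s = (c, a)" "lin_poly I t = (d, b)"
      and "gt c d \<and> (\<forall>x\<in>V. gt (a x) (b x))"
    then show "(s, t) \<in> pol_rel F ar V pos I gt"
      by (intro lin_poly_pol_rel plus_strict_mono times_strict_mono sum_gt) auto
  next
    fix s t :: "('f, 'v) trm" and c a d b
    assume "s \<in> trms F ar V" "t \<in> trms F ar V"
      and "lin_poly I s = (c, a)" "lin_poly I t = (d, b)"
      and "geq c d \<and> (\<forall>x\<in>V. geq (a x) (b x))"
    then show "(s, t) \<in> pol_rel F ar V pos I geq"
      by (intro lin_poly_pol_rel plus_mono2 times_mono[THEN conjunct1] sum_geq) auto
  qed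
qed

end
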